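(* Let $a>0$, $b>0$. Then $\left(a,\,b,\,3a+\frac12-b\right)\in\mathcal{P}_{1,2}$ if and only if $a\ne\frac12$ and $b$ lies strictly between $a+\frac12$ and $2a$. Moreover, in this case, for all $x>0$, $${}_1F_2\left(a\,;b,\,3a+\tfrac12-b\,;-\tfrac{x^2}{4}\right)>\mathbb{J}_{a-\frac12}^2\left(\frac{x}{2}\right).$$
   Context: For $a,b,c>0$, ${}_1F_2\left(a\,;b,c\,;-\frac{x^2}{4}\right)=\sum_{k=0}^\infty \frac{(a)_k}{k!\,(b)_k(c)_k}\left(-\frac{x^2}{4}\right)^k$, where $(\alpha)_k=\Gamma(\alpha+k)/\Gamma(\alpha)$. $\mathcal{P}_{1,2}$ denotes the set of all triples $(a,b,c)$ of positive reals such that this function is $>0$ for all $x>0$. For $\alpha>-1$, $\mathbb{J}_\alpha(x)={}_0F_1\left(\alpha+1\,;-\frac{x^2}{4}\right)=\Gamma(\alpha+1)(x/2)^{-\alpha}J_\alpha(x)$, with $J_\alpha$ the Bessel function of the first kind. *)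

theory Defs
  imports "HOL-Analysis.Analysis"
begin

definition hyp1F2 :: "real \<Rightarrow> real \<Rightarrow> real \<Rightarrow> real \<Rightarrow> real" where
  "hyp1F2 a b c x =
     (\<Sum>k. pochhammer a k / (fact k * pochhammer b k * pochhammer c k) * (-(x^2)/4)^k)"

definition P12 :: "(real \<times> real \<times> real) set" where
  "P12 = {(a, b, c). a > 0 \<and> b > 0 \<and> c > 0 \<and> (\<forall>x>0. hyp1F2 a b c x > 0)}"

text \<open>Normalized Bessel function J_alpha(x) = 0F1(alpha+1; -x^2/4).\<close>
definition bessJ :: "real \<Rightarrow> real \<Rightarrow> real" where
  "bessJ \<alpha> x = (\<Sum>k. (-(x^2)/4)^k / (fact k * pochhammer (\<alpha> + 1) k))"

end

theory Submission
  imports Defs "HOL-Real_Asymp.Real_Asymp"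
begin

text \<open>
  Put \<open>t = x\<^sup>2/4\<close> and \<open>c = 3a + 1/2 - b\<close>. The square of the Bessel function in the theorem is
  itself a \<open>1F2\<close>, with lower parameters \<open>a + 1/2\<close> and \<open>2a\<close>, which have the same sum as \<open>b\<close> and \<open>c\<close>.

  If \<open>b\<close> lies strictly between them, Gasper's expansion writes \<open>1F2(a; b, c)\<close> as a series of
  squares of the Bessel functions of orders \<open>a - 1/2 + n\<close>. On the line \<open>b + c = 3a + 1/2\<close> its
  coefficients are products of Pochhammer symbols, they are positive, and the term \<open>n = 0\<close> is the
  claimed lower bound.

  Otherwise \<open>b\<close> and \<open>c\<close> are spread at least as far apart as \<open>a + 1/2\<close> and \<open>2a\<close>. Gauss's summation
  theorem writes the \<open>1F2\<close> with the closer pair of lower parameters as a positive combination of the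
  functions \<open>1F2(a; b + m, c)\<close> with \<open>b \<ge> c\<close>, and raising \<open>b\<close> preserves positivity. So positivity of
  \<open>1F2(a; b, c)\<close> would make the squared Bessel function positive, but it has a positive zero.
\<close>

section \<open>Series lemmas\<close>

text \<open>The ratio test in product form, so that vanishing terms are allowed.\<close>

lemma summable_of_ratio_tendsto_0:
  fixes f r :: "nat \<Rightarrow> real"
  assumes le: "\<And>n. \<bar>f (Suc n)\<bar> \<le> r n * \<bar>f n\<bar>" and r: "r \<longlonglongrightarrow> 0"
  shows "summable (\<lambda>n. \<bar>f n\<bar>)"
proof -
  have "eventually (\<lambda>n. r n < 1/2) sequentially"
    using r by (rule order_tendstoD) simp
  then obtain N where N: "\<And>n. n \<ge> N \<Longrightarrow> r n < 1/2"
    by (auto simp: eventually_sequentially)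
  show ?thesis
  proof (rule summable_ratio_test[of "1/2" N])
    fix n assume "N \<le> n"
    then have "r n * \<bar>f n\<bar> \<le> 1/2 * \<bar>f n\<bar>"
      using N[of n] by (intro mult_right_mono) auto
    then show "norm \<bar>f (Suc n)\<bar> \<le> 1/2 * norm \<bar>f n\<bar>"
      using le[of n] by simp
  qed simp
qed

text \<open>Fubini for absolutely convergent double series, by passing to unordered sums over
  pairs.\<close>

lemma suminf_swap_abs:
  fixes f :: "nat \<Rightarrow> nat \<Rightarrow> real"
  assumes row: "\<And>m. summable (\<lambda>n. \<bar>f m n\<bar>)"
    and tot: "summable (\<lambda>m. \<Sum>n. \<bar>f m n\<bar>)"
  shows "(\<lambda>m. \<Sum>n. f m n) sums (\<Sum>n. \<Sum>m. f m n)"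
proof -
  have row_on: "(\<lambda>n. norm (f m n)) summable_on UNIV" for m
    using row[of m] by (simp add: summable_on_UNIV_nonneg_real_iff)
  have row_inf: "infsum (\<lambda>n. \<bar>f m n\<bar>) UNIV = (\<Sum>n. \<bar>f m n\<bar>)" for m
    by (intro infsumI sums_nonneg_imp_has_sum summable_sums row) auto
  have nn: "0 \<le> (\<Sum>n. \<bar>f m n\<bar>)" for m
    by (intro suminf_nonneg row) auto
  have "(\<lambda>p. norm ((\<lambda>(m, n). f m n) p)) summable_on (Sigma UNIV (\<lambda>_. UNIV))"
    unfolding Infinite_Sum.abs_summable_on_Sigma_iff
    using row_on tot nn by (auto simp: row_inf summable_on_UNIV_nonneg_real_iff)
  then have S: "(\<lambda>(m, n). f m n) summable_on (UNIV \<times> UNIV)"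
    by (rule abs_summable_summable)
  have S': "(\<lambda>(n, m). f m n) summable_on (UNIV \<times> UNIV)"
    using S by (subst summable_on_swap) (simp add: case_prod_unfold)
  have sw: "infsum (\<lambda>m. infsum (f m) UNIV) UNIV = infsum (\<lambda>n. infsum (\<lambda>m. f m n) UNIV) UNIV"
    using S by (rule infsum_swap_banach)
  have has_sums: "(\<lambda>m. \<Sum>n. g m n) sums (infsum (\<lambda>m. infsum (g m) UNIV) UNIV)"
    if g: "(\<lambda>(m, n). g m n) summable_on (UNIV \<times> UNIV)" for g :: "nat \<Rightarrow> nat \<Rightarrow> real"
  proof -
    have 1: "g m summable_on UNIV" for m
      using summable_on_SigmaD1[OF g, of m] by simp
    have 2: "(\<lambda>m. infsum (g m) UNIV) summable_on UNIV"
      using summable_on_Sigma_banach[OF g] by simp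
    have 3: "(\<Sum>n. g m n) = infsum (g m) UNIV" for m
      using has_sum_infsum[OF 1[of m]] by (intro sums_unique[symmetric] has_sum_imp_sums)
    show ?thesis
      unfolding 3 by (intro has_sum_imp_sums has_sum_infsum 2)
  qed
  have "(\<Sum>n. \<Sum>m. f m n) = infsum (\<lambda>m. infsum (f m) UNIV) UNIV"
    unfolding sw by (rule sums_unique[symmetric], rule has_sums) (fact S')
  then show ?thesis using has_sums[OF S] by simp
qed

lemma pochhammer_mono_left:
  fixes x y :: real
  assumes "0 < x" "x \<le> y" shows "pochhammer x n \<le> pochhammer y n"
proof (induction n)
  case (Suc n)
  then show ?case
    using assms pochhammer_pos[of x n] pochhammer_pos[of y n]
    by (auto simp: pochhammer_Suc intro!: mult_mono)
qed simp

section \<open>The functions 0F1 and 1F2\<close>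

text \<open>The sign of the argument \<open>-t\<close> sits in the coefficients, so that the
  functions are power series in \<open>t\<close> and can be differentiated termwise.\<close>

definition coef01 :: "real \<Rightarrow> nat \<Rightarrow> real" where
  "coef01 c k = (-1)^k / (fact k * pochhammer c k)"

definition coef12 :: "real \<Rightarrow> real \<Rightarrow> real \<Rightarrow> nat \<Rightarrow> real" where
  "coef12 a b c k = (-1)^k * pochhammer a k / (fact k * pochhammer b k * pochhammer c k)"

definition F01 :: "real \<Rightarrow> real \<Rightarrow> real" where
  "F01 c t = (\<Sum>k. coef01 c k * t^k)"

definition F12 :: "real \<Rightarrow> real \<Rightarrow> real \<Rightarrow> real \<Rightarrow> real" where
  "F12 a b c t = (\<Sum>k. coef12 a b c k * t^k)"

lemma hyp1F2_eq_F12: "hyp1F2 a b c x = F12 a b c (x^2/4)"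
  unfolding hyp1F2_def F12_def coef12_def
  by (intro suminf_cong) (simp add: power_divide power_minus[of "x^2/4"])

lemma bessJ_eq_F01: "bessJ \<alpha> x = F01 (\<alpha> + 1) (x^2/4)"
  unfolding bessJ_def F01_def coef01_def
  by (intro suminf_cong) (simp add: power_divide power_minus[of "x^2/4"])

lemma F12_commute: "F12 a b c = F12 a c b"
  unfolding F12_def coef12_def by (simp add: mult_ac)

lemma coef12_Suc:
  assumes "b > 0" "c > 0"
  shows "coef12 a b c (Suc k) = - ((a + k) / ((k + 1) * (b + k) * (c + k))) * coef12 a b c k"
  using assms by (simp add: coef12_def pochhammer_Suc divide_simps)

lemma coef01_Suc:
  assumes "c > 0"
  shows "coef01 c (Suc k) = - (1 / ((k + 1) * (c + k))) * coef01 c k"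
  using assms by (simp add: coef01_def pochhammer_Suc divide_simps)

lemma summable_abs_F12:
  assumes "b > 0" "c > 0"
  shows "summable (\<lambda>k. \<bar>coef12 a b c k * t^k\<bar>)"
proof (rule summable_of_ratio_tendsto_0)
  show "(\<lambda>k::nat. \<bar>(a + k) / ((k + 1) * (b + k) * (c + k))\<bar> * \<bar>t\<bar>) \<longlonglongrightarrow> 0"
    by (intro tendsto_mult_left_zero tendsto_rabs_zero) real_asymp
qed (simp add: coef12_Suc assms abs_mult mult_ac)

lemma summable_abs_F01:
  assumes "c > 0"
  shows "summable (\<lambda>k. \<bar>coef01 c k * t^k\<bar>)"
proof (rule summable_of_ratio_tendsto_0)
  show "(\<lambda>k::nat. \<bar>1 / ((k + 1) * (c + k))\<bar> * \<bar>t\<bar>) \<longlonglongrightarrow> 0"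
    by (intro tendsto_mult_left_zero tendsto_rabs_zero) real_asymp
qed (simp add: coef01_Suc assms abs_mult mult_ac)

lemmas summable_F12 = summable_rabs_cancel[OF summable_abs_F12]
lemmas summable_F01 = summable_rabs_cancel[OF summable_abs_F01]

section \<open>The square of a Bessel function\<close>

text \<open>Multiplied by \<open>pochhammer c k ^ 2\<close>, each summand becomes a product of two
  generalized binomial coefficients with upper entry \<open>c + k - 1\<close>; Vandermonde's
  convolution adds them up.\<close>

lemma sum_inverse_pochhammer_convolution:
  fixes c :: real
  assumes "c > 0"
  shows "(\<Sum>i\<le>k. 1 / (fact i * pochhammer c i * (fact (k - i) * pochhammer c (k - i))))
    = pochhammer (2*c - 1 + k) k / (fact k * pochhammer c k ^ 2)"
proof -
  have "1 / (fact i * pochhammer c i * (fact (k - i) * pochhammer c (k - i)))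
      = ((c + k - 1) gchoose i) * ((c + k - 1) gchoose (k - i)) / pochhammer c k ^ 2"
    if "i \<le> k" for i
  proof -
    have "pochhammer c k ^ 2 = (pochhammer c i * pochhammer (c + i) (k - i))
        * (pochhammer c (k - i) * pochhammer (c + (k - i)) i)"
      unfolding power2_eq_square using that pochhammer_product[of i k c] pochhammer_product[of "k - i" k c] by (auto simp: of_nat_diff)
    moreover have "(c + k - 1) gchoose (k - i) = pochhammer (c + i) (k - i) / fact (k - i)"
      "(c + k - 1) gchoose i = pochhammer (c + (k - i)) i / fact i"
      using that by (simp_all add: gbinomial_pochhammer' of_nat_diff algebra_simps)
    moreover have "pochhammer c i > 0" "pochhammer c (k - i) > 0"
      "pochhammer (c + i) (k - i) > 0" "pochhammer (c + (k - i)) i > 0"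
      using assms by (auto intro!: pochhammer_pos)
    ultimately show ?thesis
      by simp
  qed
  then have "(\<Sum>i\<le>k. 1 / (fact i * pochhammer c i * (fact (k - i) * pochhammer c (k - i))))
      = (\<Sum>i\<in>{0..k}. ((c + k - 1) gchoose i) * ((c + k - 1) gchoose (k - i))) / pochhammer c k ^ 2"
    by (auto simp: sum_divide_distrib atLeast0AtMost intro!: sum.cong)
  also have "\<dots> = ((c + k - 1 + (c + k - 1)) gchoose k) / pochhammer c k ^ 2"
    by (simp add: gbinomial_Vandermonde)
  also have "\<dots> = pochhammer (2*c - 1 + k) k / (fact k * pochhammer c k ^ 2)"
    by (simp add: gbinomial_pochhammer' algebra_simps)
  finally show ?thesis .
qed

text \<open>Cauchy product. The convolution above leaves \<open>pochhammer (2*a + k) k\<close>,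
  which the duplication formula for \<open>pochhammer (2*a) (2*k)\<close> rewrites with a factor
  \<open>4^k\<close>; the argument \<open>t/4\<close> absorbs it.\<close>

lemma F01_square:
  assumes "a > 0"
  shows "(F01 (a + 1/2) (t/4))^2 = F12 a (a + 1/2) (2*a) t"
proof -
  let ?c = "a + 1/2"
  have "(F01 ?c (t/4))^2 = (\<Sum>k. \<Sum>i\<le>k. (coef01 ?c i * (t/4)^i) * (coef01 ?c (k - i) * (t/4)^(k - i)))"
    unfolding power2_eq_square F01_def
    using assms by (intro Cauchy_product) (use summable_abs_F01[of ?c "t/4"] in auto)
  also have "\<dots> = F12 a ?c (2*a) t"
    unfolding F12_def
  proof (rule suminf_cong)
    fix k
    have "(\<Sum>i\<le>k. (coef01 ?c i * (t/4)^i) * (coef01 ?c (k - i) * (t/4)^(k - i)))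
       = (\<Sum>i\<le>k. (-t/4)^k * (1 / (fact i * pochhammer ?c i * (fact (k - i) * pochhammer ?c (k - i)))))"
    proof (rule sum.cong)
      fix i assume "i \<in> {..k}"
      then have "k = i + (k - i)" by simp
      then have p: "x^k = x^i * x^(k - i)" for x :: real by (metis power_add)
      show "(coef01 ?c i * (t/4)^i) * (coef01 ?c (k - i) * (t/4)^(k - i))
         = (-t/4)^k * (1 / (fact i * pochhammer ?c i * (fact (k - i) * pochhammer ?c (k - i))))"
        unfolding coef01_def p by (simp add: power_minus[of "t/4"] power_divide)
    qed simp
    also have "\<dots> = (-t/4)^k * (pochhammer (2*a + k) k / (fact k * pochhammer ?c k ^ 2))"
      unfolding sum_distrib_left[symmetric]
      using sum_inverse_pochhammer_convolution[of ?c k] assms by (simp add: algebra_simps)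
    also have "\<dots> = coef12 a ?c (2*a) k * t^k"
    proof -
      have "pochhammer (2*a) k * pochhammer (2*a + k) k = 4^k * pochhammer a k * pochhammer ?c k"
        using pochhammer_product'[of "2*a" k k] pochhammer_double[of a k]
        by (simp add: mult_2[of k, symmetric] power_mult)
      moreover have "pochhammer (2*a) k > 0" "pochhammer ?c k > 0"
        using assms by (auto intro!: pochhammer_pos)
      ultimately have "pochhammer (2*a + k) k = 4^k * pochhammer a k * pochhammer ?c k / pochhammer (2*a) k"
        by (simp add: field_simps)
      then show ?thesis
        using \<open>pochhammer (2*a) k > 0\<close> \<open>pochhammer ?c k > 0\<close>
        by (simp add: coef12_def power2_eq_square power_divide power_minus[of "t/4"] mult_ac)
    qed
    finally show "(\<Sum>i\<le>k. (coef01 ?c i * (t/4)^i) * (coef01 ?c (k - i) * (t/4)^(k - i)))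
      = coef12 a ?c (2*a) k * t^k" .
  qed
  finally show ?thesis .
qed

section \<open>Raising a lower parameter, and zeros of Bessel functions\<close>

text \<open>The operator \<open>t d/dt\<close> multiplies the k-th coefficient by \<open>k\<close>;
  through it, coefficient relations become differential equations.\<close>

lemma euler_operator_power_series:
  fixes f :: "nat \<Rightarrow> real"
  assumes "\<And>t. summable (\<lambda>k. f k * t^k)"
  shows "(\<lambda>k. k * f k * t^k) sums (t * (\<Sum>n. diffs f n * t^n))"
proof -
  have "summable (\<lambda>n. diffs f n * t^n)"
    by (rule termdiff_converges_all) (rule assms)
  from sums_mult[OF diffs_equiv[OF this], of t]
  have "(\<lambda>n. t * (n * f n * t^(n - Suc 0))) sums (t * (\<Sum>n. diffs f n * t^n))"
    by simp
  moreover have "t * (n * f n * t^(n - Suc 0)) = n * f n * t^n" for n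
    by (cases n) auto
  ultimately show ?thesis by simp
qed

text \<open>The coefficient relation says \<open>b G + t G' = b F\<close>. Hence
  \<open>t^b G\<close> has the derivative \<open>b t^(b-1) F > 0\<close> for \<open>t > 0\<close>,
  and it vanishes at 0.\<close>

lemma power_series_raise:
  fixes f g :: "nat \<Rightarrow> real"
  assumes b: "b > 0"
    and f: "\<And>t. summable (\<lambda>k. f k * t^k)" and g: "\<And>t. summable (\<lambda>k. g k * t^k)"
    and fg: "\<And>k. (b + k) * g k = b * f k"
    and pos: "\<And>t. t > 0 \<Longrightarrow> (\<Sum>k. f k * t^k) > 0"
    and "t > 0"
  shows "(\<Sum>k. g k * t^k) > 0"
proof -
  define F G where "F t = (\<Sum>k. f k * t^k)" and "G t = (\<Sum>k. g k * t^k)" for t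
  define D where "D t = (\<Sum>n. diffs g n * t^n)" for t
  have D: "(G has_field_derivative D t) (at t)" for t
    unfolding G_def[abs_def] D_def by (rule termdiffs_strong_converges_everywhere) (rule g)
  have E: "(\<lambda>k. k * g k * t^k) sums (t * D t)" for t
    unfolding D_def by (rule euler_operator_power_series) (rule g)
  have ode: "b * G t + t * D t = b * F t" for t
  proof -
    have "(\<lambda>k. b * (g k * t^k) + k * g k * t^k) sums (b * G t + t * D t)"
      unfolding G_def by (intro sums_add sums_mult E summable_sums g)
    moreover have "b * (g k * t^k) + k * g k * t^k = b * (f k * t^k)" for k
      using arg_cong[OF fg[of k], of "\<lambda>x. x * t^k"] by (simp add: algebra_simps)
    ultimately have "(\<lambda>k. b * (f k * t^k)) sums (b * G t + t * D t)" by simp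
    moreover have "(\<lambda>k. b * (f k * t^k)) sums (b * F t)"
      unfolding F_def by (intro sums_mult summable_sums f)
    ultimately show ?thesis by (rule sums_unique2)
  qed
  define \<Phi> where "\<Phi> t = t powr b * G t" for t
  have "\<Phi> 0 < \<Phi> t"
  \<comment> \<open>For \<open>b < 1\<close> the function \<open>t powr b\<close> is not
    differentiable at 0; continuity at the end points suffices.\<close>
  proof (rule DERIV_pos_imp_increasing_open[OF \<open>t > 0\<close>])
    fix x :: real assume x: "0 < x"
    have "(\<Phi> has_field_derivative (b * x powr (b - 1) * G x + x powr b * D x)) (at x)"
      unfolding \<Phi>_def using x by (auto intro!: derivative_eq_intros D)
    also have "b * x powr (b - 1) * G x + x powr b * D x = x powr (b - 1) * (b * F x)"
      using x by (simp add: ode[symmetric] powr_diff field_simps)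
    finally show "\<exists>y. DERIV \<Phi> x :> y \<and> y > 0"
      using x pos[of x] b unfolding F_def by (intro exI[of _ "x powr (b - 1) * (b * F x)"]) (auto simp: F_def)
  next
    have "continuous_on {0..t} G" by (meson D DERIV_isCont continuous_at_imp_continuous_on)
    then show "continuous_on {0..t} \<Phi>"
      unfolding \<Phi>_def using b by (intro continuous_on_mult continuous_on_powr' continuous_intros) auto
  qed
  then show ?thesis
    using b \<open>t > 0\<close> by (simp add: \<Phi>_def G_def[symmetric] zero_less_mult_iff)
qed

lemma pochhammer_raise:
  fixes x :: real
  assumes "x > 0"
  shows "(x + k) / pochhammer (x + 1) k = x / pochhammer x k"
proof -
  have "pochhammer (x + 1) k > 0" "pochhammer x k > 0"
    using assms by (auto intro!: pochhammer_pos)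
  then show ?thesis
    using pochhammer_rec[of x k] pochhammer_Suc[of x k] by (simp add: frac_eq_eq mult_ac)
qed

lemma coef12_raise:
  assumes "b > 0"
  shows "(b + k) * coef12 a (b + 1) c k = b * coef12 a b c k"
proof -
  have "(b + k) * coef12 a (b + 1) c k = (b + k) / pochhammer (b + 1) k * ((-1)^k * pochhammer a k / (fact k * pochhammer c k))"
    by (simp add: coef12_def)
  also have "\<dots> = b * coef12 a b c k"
    unfolding pochhammer_raise[OF assms] by (simp add: coef12_def)
  finally show ?thesis .
qed

lemma coef01_raise:
  assumes "c > 0"
  shows "(c + k) * coef01 (c + 1) k = c * coef01 c k"
proof -
  have "(c + k) * coef01 (c + 1) k = (c + k) / pochhammer (c + 1) k * ((-1)^k / fact k)"
    by (simp add: coef01_def)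
  also have "\<dots> = c * coef01 c k"
    unfolding pochhammer_raise[OF assms] by (simp add: coef01_def)
  finally show ?thesis .
qed

lemma F12_pos_raise:
  assumes b: "b > 0" and c: "c > 0" and pos: "\<And>t. t > 0 \<Longrightarrow> F12 a b c t > 0" and "t > 0"
  shows "F12 a (b + real m) c t > 0"
  using \<open>t > 0\<close>
proof (induction m arbitrary: t)
  case 0
  then show ?case using pos by simp
next
  case (Suc m)
  let ?B = "b + real m"
  have B: "?B > 0" and B1: "?B + 1 > 0" using b by auto
  have "(\<Sum>k. coef12 a (?B + 1) c k * t^k) > 0"
    by (rule power_series_raise[OF B summable_F12[OF B c] summable_F12[OF B1 c] coef12_raise[OF B]
          Suc.IH[unfolded F12_def] Suc.prems])
  then show ?case by (simp add: F12_def add_ac)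
qed

text \<open>If \<open>F01 c\<close> had no zero, then \<open>h = c F01 c / F01 (c + 1)\<close>, the reciprocal of its negated
  logarithmic derivative, would stay positive although \<open>h' \<le> - 1/2\<close> for large \<open>t\<close>.\<close>
lemma F01_has_zero:
  assumes c: "c > 0"
  shows "\<exists>t>0. F01 c t = 0"
proof (rule ccontr)
  assume no: "\<not> ?thesis"
  let ?f = "F01 c" and ?g = "F01 (c + 1)"
  have sf: "summable (\<lambda>k. coef01 c k * t^k)" and sg: "summable (\<lambda>k. coef01 (c + 1) k * t^k)" for t
    using c by (auto intro!: summable_F01)
  have fg: "(c + k) * coef01 (c + 1) k = c * coef01 c k" for k
    by (rule coef01_raise[OF c])
  define D where "D t = (\<Sum>n. diffs (coef01 c) n * t^n)" for t
  have D: "(?f has_field_derivative D t) (at t)" for t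
    unfolding F01_def[abs_def] D_def by (rule termdiffs_strong_converges_everywhere) (rule sf)
  have E: "(\<lambda>k. k * coef01 c k * t^k) sums (t * D t)" for t
    unfolding D_def by (rule euler_operator_power_series) (rule sf)
  define D' where "D' t = (\<Sum>n. diffs (coef01 (c + 1)) n * t^n)" for t
  have D': "(?g has_field_derivative D' t) (at t)" for t
    unfolding F01_def[abs_def] D'_def by (rule termdiffs_strong_converges_everywhere) (rule sg)
  have E': "(\<lambda>k. k * coef01 (c + 1) k * t^k) sums (t * D' t)" for t
    unfolding D'_def by (rule euler_operator_power_series) (rule sg)
  \<comment> \<open>An index shift: \<open>Suc k * coef01 c (Suc k)\<close> equals
    \<open>- coef01 (c + 1) k / c\<close>.\<close>
  have Df: "D t = - ?g t / c" if "t > 0" for t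
  proof -
    have "(\<lambda>k. Suc k * coef01 c (Suc k) * t^(Suc k)) sums (t * D t)"
      using E[of t] by (subst sums_Suc_iff) simp
    moreover have "Suc k * coef01 c (Suc k) * t^(Suc k) = (- t / c) * (coef01 (c + 1) k * t^k)" for k
    proof -
      have "Suc k * coef01 c (Suc k) = - (coef01 c k / (c + k))"
        using c by (simp add: coef01_Suc divide_simps)
      also have "\<dots> = - (coef01 (c + 1) k / c)"
        using c fg[of k] by (simp add: divide_simps mult_ac)
      finally show ?thesis by simp
    qed
    ultimately have "(\<lambda>k. (- t / c) * (coef01 (c + 1) k * t^k)) sums (t * D t)" by simp
    moreover have "(\<lambda>k. (- t / c) * (coef01 (c + 1) k * t^k)) sums ((- t / c) * ?g t)"
      unfolding F01_def by (intro sums_mult summable_sums sg)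
    ultimately have "t * D t = (- t / c) * ?g t" by (rule sums_unique2)
    then have "t * D t = t * (- ?g t / c)" by simp
    then show ?thesis using that unfolding mult_cancel_left by simp
  qed
  \<comment> \<open>The raising relation \<open>fg\<close> read as a differential equation:
    \<open>c g + t g' = c f\<close>.\<close>
  have Dg: "D' t = c * (?f t - ?g t) / t" if "t > 0" for t
  proof -
    have "(\<lambda>k. c * (coef01 (c + 1) k * t^k) + k * coef01 (c + 1) k * t^k) sums (c * ?g t + t * D' t)"
      unfolding F01_def by (intro sums_add sums_mult E' summable_sums sg)
    moreover have "c * (coef01 (c + 1) k * t^k) + k * coef01 (c + 1) k * t^k = c * (coef01 c k * t^k)" for k
      using arg_cong[OF fg[of k], of "\<lambda>x. x * t^k"] by (simp add: algebra_simps)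
    ultimately have "(\<lambda>k. c * (coef01 c k * t^k)) sums (c * ?g t + t * D' t)" by simp
    moreover have "(\<lambda>k. c * (coef01 c k * t^k)) sums (c * ?f t)"
      unfolding F01_def by (intro sums_mult summable_sums sf)
    ultimately have "c * ?g t + t * D' t = c * ?f t" by (rule sums_unique2)
    then show ?thesis using that by (simp add: field_simps)
  qed
  \<comment> \<open>\<open>?f\<close> starts at 1 and has no zero, so it stays positive; raising the
    parameter passes this on to \<open>?g\<close>.\<close>
  have fpos: "?f t > 0" if t: "t > 0" for t
  proof (rule ccontr)
    assume "\<not> ?f t > 0"
    moreover have "?f 0 = 1" by (simp add: F01_def powser_zero) (simp add: coef01_def)
    moreover have "continuous_on {0..t} ?f" by (meson D DERIV_isCont continuous_at_imp_continuous_on)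
    ultimately obtain u where "0 \<le> u" "u \<le> t" "?f u = 0"
      using IVT2'[of ?f t 0 0] t by auto
    moreover from this have "u \<noteq> 0" using \<open>?f 0 = 1\<close> by auto
    ultimately show False using no by auto
  qed
  have gpos: "?g t > 0" if "t > 0" for t
    unfolding F01_def
    by (rule power_series_raise[OF c sf sg fg _ that]) (use fpos in \<open>auto simp: F01_def\<close>)
  define h where "h t = c * ?f t / ?g t" for t
  have h': "\<exists>y. DERIV h t :> y \<and> y \<le> - (1/2)" if "t \<ge> c^2" for t
  proof -
    have t: "t > 0" using that c by (meson less_le_trans zero_less_power)
    define r where "r = ?f t / ?g t"
    have g: "?g t > 0" by (rule gpos[OF t])
    have "DERIV h t :> (c * D t * ?g t - c * ?f t * D' t) / (?g t * ?g t)"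
      unfolding h_def using g by (intro DERIV_divide DERIV_cmult D D') simp
    \<comment> \<open>A Riccati equation for \<open>h = c r\<close>. Since
      \<open>r^2 - r \<ge> - 1/4\<close>, it gives \<open>h' \<le> - 3/4\<close> once
      \<open>t \<ge> c^2\<close>.\<close>
    also have "(c * D t * ?g t - c * ?f t * D' t) / (?g t * ?g t) = - 1 - c^2 / t * (r^2 - r)"
    proof -
      have f: "?f t = r * ?g t" using g by (simp add: r_def)
      have "c * D t * ?g t - c * ?f t * D' t = (- 1 - c^2 / t * (r^2 - r)) * (?g t * ?g t)"
        unfolding Df[OF t] Dg[OF t] f using t c by (simp add: divide_simps power2_eq_square) (simp add: algebra_simps)
      then show ?thesis using g by simp
    qed
    finally have *: "DERIV h t :> - 1 - c^2 / t * (r^2 - r)" .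
    have "r^2 - r \<ge> - (1/4)" using zero_le_power2[of "r - 1/2"] by (simp add: power2_eq_square algebra_simps)
    then have "c^2 / t * (r^2 - r) \<ge> c^2 / t * (- (1/4))"
      using t by (intro mult_left_mono) simp_all
    moreover have "c^2 / t \<le> 1" using t that by simp
    ultimately show ?thesis using * by (intro exI[of _ "- 1 - c^2 / t * (r^2 - r)"]) auto
  qed
  \<comment> \<open>Chosen so that slope at most \<open>- 1/2\<close> on \<open>[c^2, T]\<close>
    forces \<open>h T \<le> h (c^2) - (T - c^2)/2 = - 1/2\<close>.\<close>
  define T where "T = c^2 + 2 * h (c^2) + 1"
  have "c^2 > 0" using c by simp
  from c fpos[OF this] gpos[OF this] have hc: "h (c^2) > 0" unfolding h_def by simp
  have "h T + T / 2 \<le> h (c^2) + c^2 / 2"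
  proof (rule DERIV_nonpos_imp_nonincreasing[where f = "\<lambda>t. h t + t / 2"])
    show "c^2 \<le> T" using hc T_def by linarith
    fix x assume "c^2 \<le> x"
    from h'[OF this] obtain y where "DERIV h x :> y" "y \<le> - (1/2)" by blast
    then show "\<exists>y. ((\<lambda>t. h t + t / 2) has_real_derivative y) (at x) \<and> y \<le> 0"
      by (intro exI[of _ "y + 1/2"]) (auto intro!: derivative_eq_intros)
  qed
  moreover have "h T > 0"
  proof -
    have "T > 0" using T_def hc zero_le_power2[of c] by linarith
    from c fpos[OF this] gpos[OF this] show ?thesis unfolding h_def by simp
  qed
  ultimately show False using T_def by linarith
qed

section \<open>Bringing the lower parameters closer together\<close>

text \<open>The terms of the Gauss series \<open>2F1(p, q; B; 1)\<close>.\<close>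

definition gauss_term :: "real \<Rightarrow> real \<Rightarrow> real \<Rightarrow> nat \<Rightarrow> real" where
  "gauss_term p q B m = pochhammer p m * pochhammer q m / (fact m * pochhammer B m)"

lemma gauss_term_Suc:
  assumes "B > 0"
  shows "gauss_term p q B (Suc m) = (p + m) * (q + m) / ((m + 1) * (B + m)) * gauss_term p q B m"
  using assms by (simp add: gauss_term_def pochhammer_Suc divide_simps)

lemma gauss_term_nonneg: "p \<ge> 0 \<Longrightarrow> q \<ge> 0 \<Longrightarrow> B > 0 \<Longrightarrow> gauss_term p q B m \<ge> 0"
  using pochhammer_pos[of B m] prod_nonneg[of "{0..<m}" "\<lambda>i. p + real i"] prod_nonneg[of "{0..<m}" "\<lambda>i. q + real i"]
  by (simp add: gauss_term_def pochhammer_prod)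

text \<open>Raabe's test: the limit \<open>B + 1 - p - q\<close> exceeds 1. If \<open>p\<close> or
  \<open>q\<close> is 0, only the term \<open>m = 0\<close> survives and the quotients in the test
  lose their meaning, so this case is separate.\<close>

lemma summable_gauss_term:
  assumes p: "p \<ge> 0" and q: "q \<ge> 0" and B: "p + q < B"
  shows "summable (gauss_term p q B)"
proof (cases "p = 0 \<or> q = 0")
  case True
  then have "gauss_term p q B m = 0" if "m \<notin> {0}" for m
    using that by (auto simp: gauss_term_def pochhammer_0_left)
  then show ?thesis by (intro summable_finite[of "{0}"]) auto
next
  case False
  with p q have p: "p > 0" and q: "q > 0" by auto
  with B have B0: "B > 0" by simp
  have pos: "gauss_term p q B m > 0" for m
    using p q B0 by (simp add: gauss_term_def pochhammer_pos)
  have "(\<lambda>m. real m * ((real m + 1) * (B + m) / ((p + m) * (q + m)) - 1)) \<longlonglongrightarrow> B + 1 - p - q"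
    by real_asymp
  moreover have "(\<lambda>m. real m * ((real m + 1) * (B + m) / ((p + m) * (q + m)) - 1))
      = (\<lambda>m. of_nat m * (gauss_term p q B m / gauss_term p q B (Suc m) - 1))"
    using pos by (intro ext) (simp add: gauss_term_Suc[OF B0] less_imp_neq[symmetric])
  ultimately have "(\<lambda>m. ereal (of_nat m * (gauss_term p q B m / gauss_term p q B (Suc m) - 1))) \<longlonglongrightarrow> ereal (B + 1 - p - q)"
    by (simp only: lim_ereal)
  then have "liminf (\<lambda>m. ereal (of_nat m * (gauss_term p q B m / gauss_term p q B (Suc m) - 1))) = ereal (B + 1 - p - q)"
    by (intro lim_imp_Liminf) auto
  then show ?thesis
    using pos B by (intro raabes_test_convergence) (auto simp: one_ereal_def)
qed

text \<open>With \<open>T\<^sub>m\<close> the Gauss terms, the contiguous relation is the telescoping of \<open>B m T\<^sub>m\<close>, which tends to 0.\<close>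
lemma gauss_telescope:
  assumes B: "B > 0"
  shows "(B - p) * (B - q) * gauss_term p q (B + 1) m - B * (B - p - q) * gauss_term p q B m
    = B * (Suc m * gauss_term p q B (Suc m)) - B * (m * gauss_term p q B m)"
proof -
  have "gauss_term p q (B + 1) m = ((B + m) / pochhammer (B + 1) m) * (pochhammer p m * pochhammer q m / (fact m * (B + m)))"
    using B by (simp add: gauss_term_def)
  then have 1: "gauss_term p q (B + 1) m = B / (B + m) * gauss_term p q B m"
    unfolding pochhammer_raise[OF B] by (simp add: gauss_term_def mult_ac)
  have "(B - p) * (B - q) * (B / (B + m)) - B * (B - p - q)
     = B * (Suc m * ((p + m) * (q + m) / ((m + 1) * (B + m)))) - B * m"
    using B by (simp add: divide_simps add_eq_0_iff) (simp add: algebra_simps)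
  then have "((B - p) * (B - q) * (B / (B + m)) - B * (B - p - q)) * gauss_term p q B m
     = (B * (Suc m * ((p + m) * (q + m) / ((m + 1) * (B + m)))) - B * m) * gauss_term p q B m"
    by simp
  then show ?thesis
    unfolding 1 gauss_term_Suc[OF B] by (simp only: left_diff_distrib mult.assoc of_nat_add of_nat_1)
qed

lemma gauss_sum_contiguous:
  assumes p: "p \<ge> 0" and q: "q \<ge> 0" and B: "p + q < B"
  shows "(B - p) * (B - q) * (\<Sum>m. gauss_term p q (B + 1) m) = B * (B - p - q) * (\<Sum>m. gauss_term p q B m)"
proof -
  have B0: "B > 0" using assms by simp
  define P where "P m = real m * gauss_term p q B m" for m
  have S: "summable (gauss_term p q B)" and S1: "summable (gauss_term p q (B + 1))"
    using assms by (auto intro!: summable_gauss_term)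
  have "(\<lambda>m. (B - p) * (B - q) * gauss_term p q (B + 1) m - B * (B - p - q) * gauss_term p q B m)
      sums ((B - p) * (B - q) * (\<Sum>m. gauss_term p q (B + 1) m) - B * (B - p - q) * (\<Sum>m. gauss_term p q B m))"
    (is "_ sums ?R") by (intro sums_diff sums_mult summable_sums S S1)
  then have "(\<lambda>m. B * P (Suc m) - B * P m) sums ?R"
    unfolding gauss_telescope[OF B0] P_def .
  then have "(\<lambda>n. \<Sum>m<n. B * P (Suc m) - B * P m) \<longlonglongrightarrow> ?R"
    by (simp add: sums_def)
  then have "(\<lambda>n. B * P n) \<longlonglongrightarrow> ?R"
    unfolding sum_lessThan_telescope[of "\<lambda>m. B * P m"] by (simp add: P_def)
  moreover define L where "L = ?R / B"
  ultimately have lim: "P \<longlonglongrightarrow> L"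
    using tendsto_divide[OF _ tendsto_const, of "\<lambda>n. B * P n" ?R sequentially B] B0 by simp
  \<comment> \<open>A positive limit of \<open>m T\<^sub>m\<close> would bound
    \<open>T\<^sub>m\<close> below by \<open>(L/2)/m\<close> eventually, and the harmonic series
    would converge.\<close>
  have "L = 0"
  proof (rule ccontr)
    assume nz: "L \<noteq> 0"
    have "L \<ge> 0"
      using gauss_term_nonneg[OF p q B0] by (intro LIMSEQ_le_const[OF lim]) (auto simp: P_def)
    with nz have "L / 2 < L" by simp
    with lim have "eventually (\<lambda>m. P m > L / 2) sequentially"
      by (rule order_tendstoD)
    then have "eventually (\<lambda>m. norm (L / 2 * inverse (real m)) \<le> gauss_term p q B m) sequentially"
      using eventually_gt_at_top[of 0]
    proof eventually_elim
      case (elim m)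
      then show ?case using \<open>L \<ge> 0\<close> by (simp add: P_def field_simps)
    qed
    then have "summable (\<lambda>m. L / 2 * inverse (real m))"
      using S by (rule summable_comparison_test_ev)
    then have "summable (\<lambda>m. inverse (real m))"
      using nz by (subst (asm) summable_cmult_iff) auto
    then show False using not_summable_harmonic[where 'a = real] by (simp add: field_simps)
  qed
  then show ?thesis using B0 unfolding L_def by simp
qed

text \<open>Gauss's theorem in ratio form, by iterating the contiguous relation; the sum for
  \<open>n = 0\<close> stays unevaluated as a common factor.\<close>

lemma gauss_sum_shift:
  assumes p: "p \<ge> 0" and q: "q \<ge> 0" and c: "c > 0"
  shows "(\<Sum>m. gauss_term p q (c + p + q + real n) m) * (pochhammer (c + q) n * pochhammer (c + p) n)
    = (\<Sum>m. gauss_term p q (c + p + q) m) * (pochhammer (c + p + q) n * pochhammer c n)"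
proof (induction n)
  case (Suc n)
  let ?B = "c + p + q + real n"
  have "(c + q + n) * (c + p + n) * (\<Sum>m. gauss_term p q (?B + 1) m) = ?B * (c + n) * (\<Sum>m. gauss_term p q ?B m)"
    using gauss_sum_contiguous[of p q ?B] assms by (simp add: algebra_simps)
  moreover have e: "c + p + q + real (Suc n) = ?B + 1" by simp
  ultimately have "((c + q + n) * (c + p + n) * (\<Sum>m. gauss_term p q (c + p + q + real (Suc n)) m)) * (pochhammer (c + q) n * pochhammer (c + p) n)
    = (?B * (c + n) * (\<Sum>m. gauss_term p q ?B m)) * (pochhammer (c + q) n * pochhammer (c + p) n)"
    unfolding e by (simp only:)
  then have "(\<Sum>m. gauss_term p q (c + p + q + real (Suc n)) m) * (pochhammer (c + q) (Suc n) * pochhammer (c + p) (Suc n))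
    = (?B * (c + n)) * ((\<Sum>m. gauss_term p q ?B m) * (pochhammer (c + q) n * pochhammer (c + p) n))"
    by (simp only: pochhammer_Suc mult_ac)
  then show ?case unfolding Suc by (simp add: pochhammer_Suc mult_ac)
qed simp

text \<open>With \<open>b = c + p + q\<close>, both
  \<open>pochhammer b n * pochhammer (b + n) m\<close> and
  \<open>pochhammer b m * pochhammer (b + m) n\<close> are \<open>pochhammer b (m + n)\<close>. So
  the series in \<open>m\<close> is a Gauss series with lower parameter \<open>b + n\<close>, which
  the shift lemma compares with the one for \<open>n = 0\<close>.\<close>

lemma coef12_spread:
  assumes p: "p \<ge> 0" and q: "q \<ge> 0" and c: "c > 0"
  shows "(\<lambda>m. gauss_term p q (c + p + q) m * coef12 a (c + p + q + real m) c n)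
    sums ((\<Sum>m. gauss_term p q (c + p + q) m) * coef12 a (c + q) (c + p) n)"
proof -
  let ?b = "c + p + q"
  have b: "?b > 0" using assms by simp
  have "(\<lambda>m. gauss_term p q (?b + n) m) sums (\<Sum>m. gauss_term p q (?b + n) m)"
    using assms by (intro summable_sums summable_gauss_term) auto
  then have "(\<lambda>m. coef12 a ?b c n * gauss_term p q (?b + n) m) sums (coef12 a ?b c n * (\<Sum>m. gauss_term p q (?b + n) m))"
    by (rule sums_mult)
  moreover have "coef12 a ?b c n * gauss_term p q (?b + n) m = gauss_term p q ?b m * coef12 a (?b + m) c n" for m
  proof -
    have "pochhammer ?b n * pochhammer (?b + n) m = pochhammer ?b m * pochhammer (?b + m) n"
      using pochhammer_product'[of ?b n m] pochhammer_product'[of ?b m n] by (simp add: add.commute)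
    moreover have "pochhammer ?b n > 0" "pochhammer (?b + n) m > 0" "pochhammer ?b m > 0" "pochhammer (?b + m) n > 0"
      "pochhammer c n > 0"
      using b c by (auto intro!: pochhammer_pos)
    ultimately show ?thesis
      unfolding coef12_def gauss_term_def by (simp add: divide_simps)
  qed
  moreover have "coef12 a ?b c n * (\<Sum>m. gauss_term p q (?b + n) m) = (\<Sum>m. gauss_term p q ?b m) * coef12 a (c + q) (c + p) n"
  proof -
    have "pochhammer ?b n > 0" "pochhammer (c + p) n > 0" "pochhammer (c + q) n > 0" "pochhammer c n > 0"
      using assms by (auto intro!: pochhammer_pos)
    then have "(\<Sum>m. gauss_term p q (?b + n) m)
        = (\<Sum>m. gauss_term p q ?b m) * (pochhammer ?b n * pochhammer c n) / (pochhammer (c + q) n * pochhammer (c + p) n)"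
      using gauss_sum_shift[OF assms, of n] by (simp add: eq_divide_eq)
    then show ?thesis
      using \<open>pochhammer ?b n > 0\<close> \<open>pochhammer c n > 0\<close> unfolding coef12_def by (simp add: mult_ac)
  qed
  ultimately show ?thesis by simp
qed

text \<open>The coefficientwise identity, summed over \<open>n\<close>. The interchange is justified
  because raising \<open>b\<close> to \<open>b + m\<close> only shrinks the coefficients in absolute
  value.\<close>

lemma F12_spread:
  assumes p: "p \<ge> 0" and q: "q \<ge> 0" and c: "c > 0"
  shows "(\<lambda>m. gauss_term p q (c + p + q) m * F12 a (c + p + q + real m) c t)
    sums ((\<Sum>m. gauss_term p q (c + p + q) m) * F12 a (c + q) (c + p) t)"
proof -
  let ?b = "c + p + q"
  let ?w = "gauss_term p q ?b"
  have b: "?b > 0" using assms by simp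
  have w: "?w m \<ge> 0" for m using gauss_term_nonneg p q b by blast
  have sw: "summable ?w" using assms by (intro summable_gauss_term) auto
  define f where "f m n = ?w m * (coef12 a (?b + real m) c n * t^n)" for m n
  have le: "\<bar>f m n\<bar> \<le> ?w m * \<bar>coef12 a ?b c n * t^n\<bar>" for m n
  proof -
    have "pochhammer ?b n \<le> pochhammer (?b + real m) n" "pochhammer ?b n > 0" "pochhammer c n > 0"
      using b c by (auto intro!: pochhammer_mono_left pochhammer_pos)
    then have "\<bar>coef12 a (?b + real m) c n\<bar> \<le> \<bar>coef12 a ?b c n\<bar>"
      unfolding coef12_def by (auto simp: abs_mult intro!: divide_left_mono mult_mono mult_pos_pos)
    then show ?thesis
      using w[of m] unfolding f_def by (auto simp: abs_mult intro!: mult_left_mono mult_right_mono)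
  qed
  have sc: "summable (\<lambda>n. ?w m * \<bar>coef12 a ?b c n * t^n\<bar>)" for m
    by (intro summable_mult summable_abs_F12 b c)
  have row: "summable (\<lambda>n. \<bar>f m n\<bar>)" for m
    by (rule summable_comparison_test'[OF sc[of m], of 0]) (use le in auto)
  have "(\<Sum>n. \<bar>f m n\<bar>) \<le> ?w m * (\<Sum>n. \<bar>coef12 a ?b c n * t^n\<bar>)" for m
    using suminf_le[OF le row sc] suminf_mult[OF summable_abs_F12[OF b c]] by simp
  then have tot: "summable (\<lambda>m. \<Sum>n. \<bar>f m n\<bar>)"
    using suminf_nonneg[OF row]
    by (intro summable_comparison_test'[OF summable_mult2[OF sw, of "\<Sum>n. \<bar>coef12 a ?b c n * t^n\<bar>"], of 0]) auto
  have 1: "(\<Sum>n. f m n) = ?w m * F12 a (?b + real m) c t" for m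
    unfolding f_def F12_def by (intro suminf_mult summable_F12) (use b c in auto)
  have 2: "(\<Sum>m. f m n) = (\<Sum>m. ?w m) * (coef12 a (c + q) (c + p) n * t^n)" for n
    using sums_mult2[OF coef12_spread[OF assms, of a n], of "t^n"] unfolding f_def
    by (intro sums_unique[symmetric]) (simp add: mult.assoc)
  have 3: "(\<Sum>n. (\<Sum>m. ?w m) * (coef12 a (c + q) (c + p) n * t^n)) = (\<Sum>m. ?w m) * F12 a (c + q) (c + p) t"
    unfolding F12_def by (intro suminf_mult summable_F12) (use assms in auto)
  show ?thesis
    using suminf_swap_abs[OF row tot] unfolding 1 2 3 .
qed

lemma F12_pos_less_spread:
  assumes p: "p \<ge> 0" and q: "q \<ge> 0" and c: "c > 0"
    and pos: "\<And>t. t > 0 \<Longrightarrow> F12 a (c + p + q) c t > 0" and t: "t > 0"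
  shows "F12 a (c + q) (c + p) t > 0"
proof -
  let ?b = "c + p + q"
  let ?w = "gauss_term p q ?b"
  have b: "?b > 0" using assms by simp
  have w: "?w m \<ge> 0" for m using gauss_term_nonneg p q b by blast
  have w0: "?w 0 = 1" by (simp add: gauss_term_def)
  have F: "F12 a (?b + real m) c t > 0" for m
    by (rule F12_pos_raise[OF b c pos t])
  \<comment> \<open>The term \<open>m = 0\<close> has weight 1 and makes the sum strictly positive,
    even when \<open>p\<close> or \<open>q\<close> is 0 and all other weights vanish.\<close>
  have "0 < (\<Sum>m. ?w m * F12 a (?b + real m) c t)"
    using F[of 0] by (intro suminf_pos2[of _ 0] sums_summable[OF F12_spread[OF p q c]])
      (auto intro!: mult_nonneg_nonneg w less_imp_le[OF F] simp: w0)
  also have "\<dots> = (\<Sum>m. ?w m) * F12 a (c + q) (c + p) t"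
    by (rule sums_unique[symmetric, OF F12_spread[OF p q c]])
  \<comment> \<open>The total weight is nonnegative and the product is positive, so the other factor
    is positive.\<close>
  finally show ?thesis
    using suminf_nonneg[OF summable_gauss_term w] assms by (auto simp: zero_less_mult_iff)
qed

section \<open>Expansion into squares\<close>

text \<open>
  The \<open>vwp_term s b c k n\<close> are, up to a factor independent of \<open>n\<close>, the terms of the terminating
  very-well-poised \<open>5F4(s - 1, (s + 1)/2, s - b, s - c, -k; (s - 1)/2, b, c, s + k; 1)\<close>. The factor
  \<open>(s - 1)\<^sub>n (s - 1 + 2n)/(s - 1)\<close> is written without the division, so that \<open>s = 1\<close> is covered.
\<close>

definition vwp_weight :: "real \<Rightarrow> nat \<Rightarrow> real" where
  "vwp_weight s n = (case n of 0 \<Rightarrow> 1 | Suc m \<Rightarrow> pochhammer s m * (s + 2 * real m + 1) / fact n)"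

definition vwp_ratio :: "real \<Rightarrow> real \<Rightarrow> real \<Rightarrow> nat \<Rightarrow> real" where
  "vwp_ratio s b c n = pochhammer (s - b) n * pochhammer (s - c) n / (pochhammer b n * pochhammer c n)"

definition vwp_term :: "real \<Rightarrow> real \<Rightarrow> real \<Rightarrow> nat \<Rightarrow> nat \<Rightarrow> real" where
  "vwp_term s b c k n = (-1)^n * vwp_weight s n * vwp_ratio s b c n / (fact (k - n) * pochhammer s (k + n))"

text \<open>The expected value \<open>S(k)\<close> of the full sum satisfies
  \<open>(k+1)(b+k)(c+k) S(k+1) = (b+c-s+k) S(k)\<close>. Applied to single terms, this recurrence
  leaves a defect that telescopes in \<open>n\<close>; the right side is the telescoped
  form.\<close>

lemma vwp_partial_sum:
  assumes s: "s > 0" and b: "b > 0" and c: "c > 0"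
  shows "N \<le> k \<Longrightarrow> (\<Sum>n\<le>N. (real k + 1) * (b + k) * (c + k) * vwp_term s b c (Suc k) n - (b + c - s + k) * vwp_term s b c k n)
    = (-1)^N * pochhammer s N * pochhammer (s - b) (Suc N) * pochhammer (s - c) (Suc N)
       / (fact N * pochhammer b N * pochhammer c N * fact (k - N) * pochhammer s (Suc (k + N)))"
proof (induction N)
  case 0
  have "pochhammer s k > 0" using s by (rule pochhammer_pos)
  then show ?case
    using s by (simp add: vwp_term_def vwp_weight_def vwp_ratio_def pochhammer_Suc divide_simps add_eq_0_iff)
      (simp add: algebra_simps)
next
  case (Suc N)
  \<comment> \<open>This replaces the truncated differences \<open>k - N\<close> and
    \<open>k - Suc N\<close> by \<open>j + 1\<close> and \<open>j\<close>.\<close>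
  then obtain j where k: "k = Suc (N + j)"
    by (metis Suc_le_D add_Suc le_Suc_ex)
  define A P Q where "A = pochhammer s N" and "P = pochhammer (s - b) (Suc N) * pochhammer (s - c) (Suc N)"
    and "Q = pochhammer s (Suc (k + N))"
  \<comment> \<open>The common factor of all four quantities below; after its removal only the
    rational identity \<open>id\<close> remains.\<close>
  define Y where "Y = (-1)^N * A * P / (fact N * fact j * pochhammer b N * pochhammer c N * Q)"
  have pos: "A > 0" "Q > 0" "pochhammer b N > 0" "pochhammer c N > 0"
    using assms by (auto simp: A_def Q_def intro!: pochhammer_pos)
  have nz: "b + N \<noteq> 0" "c + N \<noteq> 0" "s + k + N + 1 \<noteq> 0" "real N + 1 \<noteq> 0" "real j + 1 \<noteq> 0"
    using assms by (auto simp: add_eq_0_iff)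
  have Q': "pochhammer s (Suc (Suc (k + N))) = Q * (s + k + N + 1)"
    unfolding Q_def by (subst pochhammer_Suc) (simp add: algebra_simps)
  have 1: "vwp_term s b c (Suc k) (Suc N) = - Y * ((s + 2 * real N + 1) / ((real N + 1) * (b + N) * (c + N) * (real j + 1) * (s + k + N + 1)))"
  proof -
    have "Suc k - Suc N = Suc j" "Suc k + Suc N = Suc (Suc (k + N))" using k by auto
    then show ?thesis
      unfolding vwp_term_def vwp_weight_def vwp_ratio_def Y_def
      by (simp only: Q' nat.case power_Suc fact_Suc pochhammer_Suc[of b] pochhammer_Suc[of c] A_def[symmetric] P_def[symmetric])
        (use pos nz in \<open>simp add: divide_simps add.commute[of 1]\<close>)
  qed
  have 2: "vwp_term s b c k (Suc N) = - Y * ((s + 2 * real N + 1) / ((real N + 1) * (b + N) * (c + N)))"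
  proof -
    have "k - Suc N = j" "k + Suc N = Suc (k + N)" using k by auto
    then show ?thesis
      unfolding vwp_term_def vwp_weight_def vwp_ratio_def Y_def
      by (simp only: Q_def[symmetric] nat.case power_Suc fact_Suc pochhammer_Suc[of b] pochhammer_Suc[of c] A_def[symmetric] P_def[symmetric])
        (use pos nz in \<open>simp add: divide_simps add.commute[of 1]\<close>)
  qed
  have 3: "(-1)^N * pochhammer s N * pochhammer (s - b) (Suc N) * pochhammer (s - c) (Suc N)
       / (fact N * pochhammer b N * pochhammer c N * fact (k - N) * pochhammer s (Suc (k + N))) = Y * (1 / (real j + 1))"
  proof -
    have "k - N = Suc j" using k by simp
    then show ?thesis
      unfolding Y_def A_def P_def Q_def by (simp add: mult_ac)
  qed
  have 4: "(-1)^Suc N * pochhammer s (Suc N) * pochhammer (s - b) (Suc (Suc N)) * pochhammer (s - c) (Suc (Suc N))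
       / (fact (Suc N) * pochhammer b (Suc N) * pochhammer c (Suc N) * fact (k - Suc N) * pochhammer s (Suc (k + Suc N)))
      = - Y * ((s + N) * (s - b + N + 1) * (s - c + N + 1) / ((real N + 1) * (b + N) * (c + N) * (s + k + N + 1)))"
  proof -
    have "k - Suc N = j" "k + Suc N = Suc (k + N)" using k by auto
    moreover have "pochhammer (s - b) (Suc (Suc N)) * pochhammer (s - c) (Suc (Suc N)) = P * ((s - b + N + 1) * (s - c + N + 1))"
    proof -
      have "pochhammer x (Suc (Suc N)) = pochhammer x (Suc N) * (x + N + 1)" for x :: real
        by (subst pochhammer_Suc) simp
      then show ?thesis unfolding P_def by (simp only: mult_ac)
    qed
    moreover have "pochhammer s (Suc N) = A * (s + N)" by (simp add: A_def pochhammer_Suc)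
    ultimately show ?thesis
      unfolding Y_def
      by (simp only: Q' power_Suc fact_Suc pochhammer_Suc[of b] pochhammer_Suc[of c] mult.assoc)
        (use pos nz in \<open>simp add: divide_simps add.commute[of 1]\<close>)
  qed
  have id: "1 / (real j + 1) + ((real k + 1) * (b + k) * (c + k) * - ((s + 2 * real N + 1) / ((real N + 1) * (b + N) * (c + N) * (real j + 1) * (s + k + N + 1)))
      - (b + c - s + k) * - ((s + 2 * real N + 1) / ((real N + 1) * (b + N) * (c + N))))
      = - ((s + N) * (s - b + N + 1) * (s - c + N + 1) / ((real N + 1) * (b + N) * (c + N) * (s + k + N + 1)))"
  proof -
    have K: "real k = N + j + 1" using k by simp
    have poly: "(real N + 1) * (b + N) * (c + N) * (s + k + N + 1) - (real k + 1) * (b + k) * (c + k) * (s + 2 * real N + 1)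
        + (b + c - s + k) * (s + 2 * real N + 1) * (real j + 1) * (s + k + N + 1)
      = - ((s + N) * (s - b + N + 1) * (s - c + N + 1) * (real j + 1))"
      unfolding of_nat_add of_nat_mult of_nat_numeral of_nat_1 K by algebra
    \<comment> \<open>Clears the denominators, with \<open>d = (N+1)(b+N)(c+N)\<close>,
      \<open>e = j+1\<close> and \<open>f = s+k+N+1\<close>.\<close>
    have key: "1 / e + (X * - (u / (d * e * f)) - Z * - (u / d)) = - (V / (d * f))"
      if "d * f - X * u + Z * u * e * f = - (V * e)" "d \<noteq> 0" "e \<noteq> 0" "f \<noteq> 0" for d e f X u Z V :: real
    proof -
      have "1 / e + (X * - (u / (d * e * f)) - Z * - (u / d)) = (d * f - X * u + Z * u * e * f) / (d * e * f)"
        using that(2-4) by (simp add: add_divide_distrib diff_divide_distrib)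
      also have "\<dots> = - (V / (d * f))"
        unfolding that(1) using that(2-4) by simp
      finally show ?thesis .
    qed
    show ?thesis by (rule key[OF poly]) (use nz in auto)
  qed
  have "N \<le> k" using Suc by simp
  show ?case
    unfolding sum.atMost_Suc Suc.IH[OF \<open>N \<le> k\<close>] 1 2 3 4
    using arg_cong[OF id, of "\<lambda>x. Y * x"] by (simp only: distrib_left right_diff_distrib mult_minus_left mult_minus_right mult.left_commute)
qed

text \<open>The terminating case of Dougall's \<open>5F4\<close> summation. The partial sum above
  with \<open>N = k\<close> cancels against the extra term \<open>n = Suc k\<close> of the next sum,
  which leaves the recurrence in \<open>k\<close>.\<close>

lemma vwp_sum:
  assumes s: "s > 0" and b: "b > 0" and c: "c > 0"
  shows "(\<Sum>n\<le>k. vwp_term s b c k n) = pochhammer (b + c - s) k / (fact k * pochhammer b k * pochhammer c k)"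
proof (induction k)
  case 0
  then show ?case by (simp add: vwp_term_def vwp_weight_def vwp_ratio_def)
next
  case (Suc k)
  let ?C = "(real k + 1) * (b + k) * (c + k)"
  define A P Q where "A = pochhammer s k" and "P = pochhammer (s - b) (Suc k) * pochhammer (s - c) (Suc k)"
    and "Q = pochhammer s (Suc (k + k))"
  have pos: "A > 0" "Q > 0" "pochhammer b k > 0" "pochhammer c k > 0"
    using assms by (auto simp: A_def Q_def intro!: pochhammer_pos)
  have nz: "b + k \<noteq> 0" "c + k \<noteq> 0" "s + 2 * real k + 1 \<noteq> 0" "real k + 1 \<noteq> 0"
    using assms by (auto simp: add_eq_0_iff)
  have Q': "pochhammer s (Suc k + Suc k) = Q * (s + 2 * real k + 1)"
    unfolding Q_def using pochhammer_Suc[of s "Suc (k + k)"] by (simp add: algebra_simps)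
  have "?C * vwp_term s b c (Suc k) (Suc k) = - ((-1)^k * A * P / (fact k * pochhammer b k * pochhammer c k * Q))"
    unfolding vwp_term_def vwp_weight_def vwp_ratio_def
    by (simp only: Q' nat.case power_Suc fact_Suc pochhammer_Suc[of b] pochhammer_Suc[of c] A_def[symmetric] P_def[symmetric])
      (use pos nz in \<open>simp add: divide_simps add.commute[of 1]\<close>)
  moreover have "(\<Sum>n\<le>k. ?C * vwp_term s b c (Suc k) n - (b + c - s + k) * vwp_term s b c k n)
      = (-1)^k * A * P / (fact k * pochhammer b k * pochhammer c k * Q)"
    using vwp_partial_sum[OF assms, of k k] unfolding A_def P_def Q_def by (simp add: mult_ac)
  moreover have "?C * (\<Sum>n\<le>Suc k. vwp_term s b c (Suc k) n) - (b + c - s + k) * (\<Sum>n\<le>k. vwp_term s b c k n)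
      = (\<Sum>n\<le>k. ?C * vwp_term s b c (Suc k) n - (b + c - s + k) * vwp_term s b c k n) + ?C * vwp_term s b c (Suc k) (Suc k)"
    by (simp add: sum_subtractf sum_distrib_left distrib_left)
  ultimately have "?C * (\<Sum>n\<le>Suc k. vwp_term s b c (Suc k) n) = (b + c - s + k) * (\<Sum>n\<le>k. vwp_term s b c k n)"
    by simp
  then have "(\<Sum>n\<le>Suc k. vwp_term s b c (Suc k) n) = (b + c - s + k) * (\<Sum>n\<le>k. vwp_term s b c k n) / ?C"
    using nz by (simp add: eq_divide_eq mult_ac)
  then show ?case unfolding Suc by (simp add: pochhammer_Suc mult_ac)
qed

section \<open>From the finite summation to Gasper's expansion\<close>

lemma vwp_ratio_Suc:
  "vwp_ratio s b c (Suc n) = (s - b + n) * (s - c + n) / ((b + n) * (c + n)) * vwp_ratio s b c n"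
  by (simp add: vwp_ratio_def pochhammer_Suc mult_ac)

text \<open>Stated from index 1 on: between the indices 0 and 1 the same formula would have
  \<open>s - 1\<close> in numerator and denominator.\<close>

lemma vwp_weight_Suc_Suc:
  assumes "s > 0"
  shows "vwp_weight s (Suc (Suc n)) = (s + n) * (s + 2 * real n + 3) / ((real n + 2) * (s + 2 * real n + 1)) * vwp_weight s (Suc n)"
proof -
  have "s + 2 * real n + 1 > 0" using assms by simp
  then show ?thesis
    unfolding vwp_weight_def nat.case fact_Suc[of "Suc n"] pochhammer_Suc of_nat_Suc
    by (simp add: add_ac mult_ac)
qed

text \<open>The factor that splits off from the n-th row of the double series below after the
  substitution \<open>k = j + n\<close>.\<close>

definition square_coef :: "real \<Rightarrow> real \<Rightarrow> real \<Rightarrow> real \<Rightarrow> nat \<Rightarrow> real" where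
  "square_coef a b c t n = vwp_weight (2*a) n * vwp_ratio (2*a) b c n * t^n * pochhammer a n
     / (pochhammer (a + 1/2) n * pochhammer (2*a) (2*n))"

lemma summable_square_coef:
  assumes a: "a > 0" and b: "b > 0" and c: "c > 0"
  shows "summable (\<lambda>n. \<bar>square_coef a b c t n\<bar>)"
proof -
  \<comment> \<open>\<open>r n * t\<close> is the quotient of the terms at \<open>n + 2\<close> and
    \<open>n + 1\<close>; it decays like \<open>t/(4 n^2)\<close>.\<close>
  define r where "r n = (2*a + n) * (2*a + 2 * real n + 3) / ((real n + 2) * (2*a + 2 * real n + 1))
      * ((2*a - b + (real n + 1)) * (2*a - c + (real n + 1)) / ((b + (real n + 1)) * (c + (real n + 1))))
      * ((a + (real n + 1)) / ((a + 1/2 + (real n + 1)) * ((2*a + 2 * (real n + 1)) * (2*a + 2 * (real n + 1) + 1))))" for n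
  have r: "r \<longlonglongrightarrow> 0" unfolding r_def by real_asymp
  have "summable (\<lambda>n. \<bar>square_coef a b c t (Suc n)\<bar>)"
  proof (rule summable_of_ratio_tendsto_0)
    show "(\<lambda>n. \<bar>r n\<bar> * \<bar>t\<bar>) \<longlonglongrightarrow> 0"
      by (intro tendsto_mult_left_zero tendsto_rabs_zero r)
    fix n
    have p: "pochhammer (2*a) (2 * Suc (Suc n)) = pochhammer (2*a) (2 * Suc n) * ((2*a + 2 * (real n + 1)) * (2*a + 2 * (real n + 1) + 1))"
      using pochhammer_Suc[of "2*a" "2 * Suc n"] pochhammer_Suc[of "2*a" "Suc (2 * Suc n)"] by (simp add: add_ac mult.assoc)
    have alg: "(A * w) * (B * v) * (t * x) * (u * D) / ((y * E) * (z * F)) = A * B * (D / (E * F)) * t * (w * v * x * u / (y * z))"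
      for A w B v x u D y E z F :: real
      by (simp add: mult_ac)
    have "square_coef a b c t (Suc (Suc n)) = r n * t * square_coef a b c t (Suc n)"
      unfolding square_coef_def p vwp_weight_Suc_Suc[OF mult_pos_pos[OF zero_less_numeral a]] vwp_ratio_Suc[of _ _ _ "Suc n"]
        pochhammer_Suc[of a "Suc n"] pochhammer_Suc[of "a + 1/2" "Suc n"] power_Suc[of t "Suc n"]
        r_def of_nat_Suc[of n] add.commute[of 1 "real n"]
      by (rule alg)
    then show "\<bar>square_coef a b c t (Suc (Suc n))\<bar> \<le> \<bar>r n\<bar> * \<bar>t\<bar> * \<bar>square_coef a b c t (Suc n)\<bar>"
      by (simp add: abs_mult)
  qed
  then show ?thesis by (subst (asm) summable_Suc_iff)
qed

text \<open>The array \<open>f n k\<close> is summed in two ways. Over \<open>n\<close> first,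
  \<open>vwp_sum\<close> gives the coefficients of the \<open>1F2\<close>; over \<open>k\<close>
  first, each row is \<open>square_coef\<close> times a \<open>1F2\<close> that
  \<open>F01_square\<close> recognizes as a square.\<close>

lemma F12_sum_of_squares:
  assumes a: "a > 0" and b: "b > 0" and c: "c > 0" and bc: "b + c = 3*a + 1/2"
  shows "(\<lambda>n. square_coef a b c t n * (F01 (a + n + 1/2) (t/4))^2) sums F12 a b c t"
proof -
  define f where "f n k = (if n \<le> k then (-1)^k * pochhammer a k / pochhammer (a + 1/2) k * vwp_term (2*a) b c k n * t^k else 0)" for n k
  let ?q = "square_coef a b c t"
  let ?d = "\<lambda>n. coef12 (a + real n) (a + real n + 1/2) (2 * (a + real n))"
  have f_shift: "f n (j + n) = ?q n * (?d n j * t^j)" for n j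
  proof -
    have "pochhammer a (j + n) = pochhammer a n * pochhammer (a + n) j"
      "pochhammer (a + 1/2) (j + n) = pochhammer (a + 1/2) n * pochhammer (a + n + 1/2) j"
      "pochhammer (2*a) (j + n + n) = pochhammer (2*a) (2*n) * pochhammer (2 * (a + n)) j"
      using pochhammer_product'[of a n j] pochhammer_product'[of "a + 1/2" n j] pochhammer_product'[of "2*a" "2*n" j]
      by (simp_all add: mult_2[of n] add_ac)
    note split = this
    have alg: "e * (x * x' * w * v * (u * u') / (y * y' * (h * (z * z')))) = w * v * u' * x / (y * z) * (e * x' / (h * y' * z') * u)"
      for e x x' w v u u' y y' h z z' :: real
      by (simp add: mult_ac)
    have "f n (j + n) = ((-1)^(j + n) * (-1)^n) * (pochhammer a (j + n) * vwp_weight (2*a) n * vwp_ratio (2*a) b c n * t^(j + n)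
        / (pochhammer (a + 1/2) (j + n) * (fact j * pochhammer (2*a) (j + n + n))))"
      by (simp add: f_def vwp_term_def mult_ac)
    also have "(-1)^(j + n) * (-1)^n = ((-1)^j :: real)"
      by (simp add: power_add mult.assoc)
    also have "(-1)^j * (pochhammer a (j + n) * vwp_weight (2*a) n * vwp_ratio (2*a) b c n * t^(j + n)
        / (pochhammer (a + 1/2) (j + n) * (fact j * pochhammer (2*a) (j + n + n)))) = ?q n * (?d n j * t^j)"
      unfolding split square_coef_def coef12_def power_add by (rule alg)
    finally show ?thesis .
  qed
  have f_zero: "f n k = 0" if "k < n" for n k
    using that by (simp add: f_def)
  \<comment> \<open>A majorant independent of \<open>n\<close>, which bounds all row sums by the one
    constant \<open>K\<close>.\<close>
  have le: "\<bar>?d n j * t^j\<bar> \<le> \<bar>coef01 (2*a) j * t^j\<bar>" for n j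
  proof -
    have "pochhammer (a + n) j \<le> pochhammer (a + n + 1/2) j" "pochhammer (2*a) j \<le> pochhammer (2 * (a + n)) j"
      "pochhammer (a + n) j > 0" "pochhammer (a + n + 1/2) j > 0" "pochhammer (2*a) j > 0"
      using a by (auto intro!: pochhammer_mono_left pochhammer_pos)
    then have "pochhammer (a + n) j / pochhammer (a + n + 1/2) j * (1 / (fact j * pochhammer (2 * (a + n)) j))
        \<le> 1 * (1 / (fact j * pochhammer (2*a) j))"
      by (intro mult_mono divide_left_mono) auto
    then have "\<bar>?d n j\<bar> \<le> \<bar>coef01 (2*a) j\<bar>"
      using \<open>pochhammer (a + n) j > 0\<close> \<open>pochhammer (a + n + 1/2) j > 0\<close> \<open>pochhammer (2*a) j > 0\<close>
        \<open>pochhammer (2*a) j \<le> pochhammer (2 * (a + n)) j\<close>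
      by (simp add: coef12_def coef01_def abs_mult mult_ac)
    then show ?thesis by (simp add: abs_mult mult_right_mono)
  qed
  have a2: "2*a > 0" using a by simp
  have sd: "summable (\<lambda>j. \<bar>?d n j * t^j\<bar>)" for n
    using a by (intro summable_abs_F12) auto
  define K where "K = (\<Sum>j. \<bar>coef01 (2*a) j * t^j\<bar>)"
  have dK: "(\<Sum>j. \<bar>?d n j * t^j\<bar>) \<le> K" for n
    unfolding K_def by (rule suminf_le[OF le sd summable_abs_F01[OF a2]])
  have abs_sums: "(\<lambda>k. \<bar>f n k\<bar>) sums (\<bar>?q n\<bar> * (\<Sum>j. \<bar>?d n j * t^j\<bar>))" for n
  proof -
    have "(\<lambda>j. \<bar>f n (j + n)\<bar>) sums (\<bar>?q n\<bar> * (\<Sum>j. \<bar>?d n j * t^j\<bar>))"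
      unfolding f_shift abs_mult[of "?q n"] by (intro sums_mult summable_sums sd)
    then show ?thesis
      by (subst (asm) sums_zero_iff_shift) (simp_all add: f_zero)
  qed
  have f_sums: "(\<lambda>k. f n k) sums (?q n * F12 (a + n) (a + n + 1/2) (2 * (a + n)) t)" for n
  proof -
    have "(\<lambda>j. f n (j + n)) sums (?q n * F12 (a + n) (a + n + 1/2) (2 * (a + n)) t)"
      unfolding f_shift F12_def using a by (intro sums_mult summable_sums summable_F12) auto
    then show ?thesis
      by (subst (asm) sums_zero_iff_shift) (simp_all add: f_zero)
  qed
  have row: "summable (\<lambda>k. \<bar>f n k\<bar>)" for n
    using abs_sums by (rule sums_summable)
  have row_sum: "(\<Sum>k. \<bar>f n k\<bar>) = \<bar>?q n\<bar> * (\<Sum>j. \<bar>?d n j * t^j\<bar>)" for n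
    by (rule sums_unique[symmetric, OF abs_sums])
  have "\<bar>?q n\<bar> * (\<Sum>j. \<bar>?d n j * t^j\<bar>) \<le> \<bar>?q n\<bar> * K" for n
    using dK by (rule mult_left_mono) simp
  then have tot: "summable (\<lambda>n. \<Sum>k. \<bar>f n k\<bar>)"
    unfolding row_sum using suminf_nonneg[OF sd]
    by (intro summable_comparison_test'[OF summable_mult2[where c = K, OF summable_square_coef[OF a b c, of t]], of 0]) (auto simp: abs_mult)
  have col: "(\<Sum>n. f n k) = coef12 a b c k * t^k" for k
  proof -
    have "(\<Sum>n. f n k) = (\<Sum>n\<le>k. f n k)"
      by (rule suminf_finite) (auto simp: f_def)
    also have "\<dots> = (-1)^k * pochhammer a k / pochhammer (a + 1/2) k * (\<Sum>n\<le>k. vwp_term (2*a) b c k n) * t^k"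
      by (simp add: f_def sum_distrib_left sum_distrib_right)
    also have "\<dots> = coef12 a b c k * t^k"
    proof -
      \<comment> \<open>The line \<open>b + c = 3a + 1/2\<close> enters here: the Pochhammer symbol
        from \<open>vwp_sum\<close> cancels the denominator
        \<open>pochhammer (a + 1/2) k\<close>.\<close>
      have "b + c - 2*a = a + 1/2" using bc by simp
      moreover have "pochhammer (a + 1/2) k > 0" using a by (intro pochhammer_pos) simp
      ultimately show ?thesis
        unfolding vwp_sum[OF a2 b c] coef12_def by simp
    qed
    finally show ?thesis .
  qed
  have sq: "(F01 (a + n + 1/2) (t/4))^2 = F12 (a + n) (a + n + 1/2) (2 * (a + n)) t" for n :: nat
    using a by (intro F01_square) simp
  show ?thesis
    using suminf_swap_abs[OF row tot]
    unfolding col sums_unique[symmetric, OF f_sums] sq F12_def[symmetric] .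
qed

section \<open>Strict lower bound, failure outside the interval, and the criterion\<close>

text \<open>At fixed \<open>t\<close>, \<open>F01\<close> tends to 1 as its parameter grows: the
  terms beyond the first sum to at most \<open>|t| K / (c + n)\<close>. This supplies a strictly
  positive term besides \<open>n = 0\<close> in the expansion into squares.\<close>

lemma F01_eventually_nonzero:
  assumes c: "c > 0"
  shows "\<exists>n\<ge>1. F01 (c + real n) t \<noteq> 0"
proof -
  define K where "K = (\<Sum>k. \<bar>coef01 c k * t^k\<bar>)"
  define n where "n = Suc (nat \<lceil>\<bar>t\<bar> * K\<rceil>)"
  let ?C = "c + real n"
  have C: "?C > 0" using c by simp
  have n: "\<bar>t\<bar> * K < n" unfolding n_def by linarith
  have le: "\<bar>coef01 ?C (Suc k) * t^(Suc k)\<bar> \<le> \<bar>t\<bar> / ?C * \<bar>coef01 c k * t^k\<bar>" for k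
  proof -
    have "pochhammer c k \<le> pochhammer (?C + 1) k" "pochhammer c k > 0"
      using c by (auto intro!: pochhammer_mono_left pochhammer_pos)
    moreover have "fact k \<le> (fact (Suc k) :: real)" by (rule fact_mono) simp
    ultimately have "fact k * pochhammer c k \<le> fact (Suc k) * pochhammer (?C + 1) k"
      by (intro mult_mono) auto
    then have "?C * (fact k * pochhammer c k) \<le> ?C * (fact (Suc k) * pochhammer (?C + 1) k)"
      using C by (intro mult_left_mono) auto
    then have "?C * (fact k * pochhammer c k) \<le> pochhammer ?C (Suc k) * fact (Suc k)"
      unfolding pochhammer_rec by (simp only: mult_ac)
    then have "1 / (pochhammer ?C (Suc k) * fact (Suc k)) \<le> 1 / (?C * (fact k * pochhammer c k))"
      using C c \<open>pochhammer c k > 0\<close> by (intro divide_left_mono mult_pos_pos pochhammer_pos) auto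
    moreover have "\<bar>coef01 ?C (Suc k)\<bar> = 1 / (pochhammer ?C (Suc k) * fact (Suc k))"
      using pochhammer_pos[OF C, of "Suc k"] by (simp add: coef01_def abs_mult mult.commute del: fact_Suc)
    moreover have "1 / (?C * (fact k * pochhammer c k)) = 1 / ?C * \<bar>coef01 c k\<bar>"
      using \<open>pochhammer c k > 0\<close> by (simp add: coef01_def abs_mult)
    ultimately have "\<bar>coef01 ?C (Suc k)\<bar> \<le> 1 / ?C * \<bar>coef01 c k\<bar>" by simp
    then have "\<bar>coef01 ?C (Suc k)\<bar> * \<bar>t^(Suc k)\<bar> \<le> 1 / ?C * \<bar>coef01 c k\<bar> * \<bar>t^(Suc k)\<bar>"
      by (rule mult_right_mono) simp
    then show ?thesis by (simp add: abs_mult mult_ac)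
  qed
  have sK: "summable (\<lambda>k. \<bar>t\<bar> / ?C * \<bar>coef01 c k * t^k\<bar>)"
    by (intro summable_mult summable_abs_F01 c)
  have sC: "summable (\<lambda>k. \<bar>coef01 ?C (Suc k) * t^(Suc k)\<bar>)"
    using summable_abs_F01[OF C] by (subst summable_Suc_iff)
  have "F01 ?C t = coef01 ?C 0 * t^0 + (\<Sum>k. coef01 ?C (Suc k) * t^(Suc k))"
    unfolding F01_def by (subst suminf_split_head[OF summable_F01[OF C]]) simp
  then have "\<bar>F01 ?C t - 1\<bar> = \<bar>\<Sum>k. coef01 ?C (Suc k) * t^(Suc k)\<bar>"
    by (simp add: coef01_def)
  also have "\<dots> \<le> (\<Sum>k. \<bar>coef01 ?C (Suc k) * t^(Suc k)\<bar>)"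
    by (rule summable_rabs[OF sC])
  also have "\<dots> \<le> (\<Sum>k. \<bar>t\<bar> / ?C * \<bar>coef01 c k * t^k\<bar>)"
    by (rule suminf_le[OF le sC sK])
  also have "\<dots> = \<bar>t\<bar> / ?C * K"
    unfolding K_def by (intro suminf_mult summable_abs_F01 c)
  also have "\<dots> < 1" using n c C by (simp add: divide_simps)
  finally have "F01 ?C t \<noteq> 0" by auto
  then show ?thesis by (intro exI[of _ n]) (simp add: n_def)
qed

text \<open>In the second case only the first factor of each nonempty Pochhammer symbol is negative,
  and the two signs cancel.\<close>

lemma pochhammer_mult_pos:
  fixes d e :: real
  assumes "(d > 0 \<and> e > 0) \<or> (-1 < d \<and> d < 0 \<and> -1 < e \<and> e < 0)"
  shows "pochhammer d n * pochhammer e n > 0"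
  using assms
proof
  assume "d > 0 \<and> e > 0"
  then show ?thesis by (simp add: pochhammer_pos)
next
  assume de: "-1 < d \<and> d < 0 \<and> -1 < e \<and> e < 0"
  show ?thesis
  proof (cases n)
    case (Suc m)
    have "pochhammer (d + 1) m > 0" "pochhammer (e + 1) m > 0" "d * e > 0"
      using de by (auto intro!: pochhammer_pos mult_neg_neg)
    then have "(d * e) * (pochhammer (d + 1) m * pochhammer (e + 1) m) > 0" by simp
    then show ?thesis unfolding Suc pochhammer_rec by (simp only: mult_ac)
  qed simp
qed

lemma F12_gt_square:
  assumes a: "a > 0" and between: "(a + 1/2 < b \<and> b < 2*a) \<or> (2*a < b \<and> b < a + 1/2)" and t: "t > 0"
  shows "F12 a b (3*a + 1/2 - b) t > (F01 (a + 1/2) (t/4))^2"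
proof -
  let ?c = "3*a + 1/2 - b"
  have b: "b > 0" and c: "?c > 0" using between a by auto
  let ?q = "square_coef a b ?c t"
  define u where "u n = ?q n * (F01 (a + real n + 1/2) (t/4))^2" for n
  have q: "?q n > 0" for n
  proof -
    have "vwp_weight (2*a) n > 0"
      using a by (cases n) (auto simp: vwp_weight_def intro!: divide_pos_pos mult_pos_pos pochhammer_pos)
    \<comment> \<open>\<open>2a - b\<close> and \<open>2a - c = b - a - 1/2\<close> are both
      positive if \<open>a + 1/2 < b < 2a\<close>, and both in \<open>(-1/2, 0)\<close> if
      \<open>2a < b < a + 1/2\<close>.\<close>
    moreover have "vwp_ratio (2*a) b ?c n > 0"
      unfolding vwp_ratio_def using a between b c
      by (intro divide_pos_pos pochhammer_mult_pos mult_pos_pos pochhammer_pos) auto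
    ultimately show ?thesis
      unfolding square_coef_def using a t by (auto intro!: divide_pos_pos mult_pos_pos pochhammer_pos)
  qed
  have S: "u sums F12 a b ?c t"
    unfolding u_def[abs_def] by (rule F12_sum_of_squares[OF a b c]) simp
  have "a + 1/2 > 0" using a by simp
  from F01_eventually_nonzero[OF this, of "t/4"] obtain n
    where n: "n \<ge> 1" "F01 (a + 1/2 + real n) (t/4) \<noteq> 0" by blast
  have e: "a + real n + 1/2 = a + 1/2 + real n" by simp
  have "u n > 0" using n q[of n] unfolding u_def e by simp
  with n have "u (Suc (n - 1)) > 0" by simp
  moreover have "u n \<ge> 0" for n using q[of n] by (simp add: u_def)
  moreover have "summable (\<lambda>n. u (Suc n))"
    using sums_summable[OF S] by (subst summable_Suc_iff)
  ultimately have "(\<Sum>n. u (Suc n)) > 0"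
    by (intro suminf_pos2[of _ "n - 1"])
  moreover have "F12 a b ?c t = u 0 + (\<Sum>n. u (Suc n))"
    using sums_unique[OF S] suminf_split_head[OF sums_summable[OF S]] by simp
  moreover have "u 0 = (F01 (a + 1/2) (t/4))^2"
    by (simp add: u_def square_coef_def vwp_weight_def vwp_ratio_def)
  ultimately show ?thesis by simp
qed

lemma F12_not_pos_if_spread:
  assumes a: "a > 0" and c: "c > 0" and bc: "b + c = 3*a + 1/2"
    and pos: "\<And>t. t > 0 \<Longrightarrow> F12 a b c t > 0" and le: "c \<le> min (2*a) (a + 1/2)"
  shows False
proof -
  have "a + 1/2 > 0" using a by simp
  then obtain t where t: "t > 0" "F01 (a + 1/2) t = 0" using F01_has_zero by blast
  \<comment> \<open>Chosen so that the closer pair \<open>(c + q, c + p)\<close> is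
    \<open>(a + 1/2, 2a)\<close>, the parameters of the squared Bessel function.\<close>
  define p q where "p = 2*a - c" and "q = a + 1/2 - c"
  have "p \<ge> 0" "q \<ge> 0" using le by (auto simp: p_def q_def)
  moreover have e: "c + p + q = b" "c + q = a + 1/2" "c + p = 2*a" using bc by (auto simp: p_def q_def)
  ultimately have "F12 a (a + 1/2) (2*a) (4*t) > 0"
    using F12_pos_less_spread[of p q c a "4*t"] pos c t unfolding e by simp
  with t show False using F01_square[OF a, of "4*t"] by simp
qed

theorem theorem3:
  fixes a b :: real
  assumes "a > 0" and "b > 0"
  shows "((a, b, 3*a + 1/2 - b) \<in> P12 \<longleftrightarrow>
           a \<noteq> 1/2 \<and> ((a + 1/2 < b \<and> b < 2*a) \<or> (2*a < b \<and> b < a + 1/2)))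
         \<and> ((a, b, 3*a + 1/2 - b) \<in> P12 \<longrightarrow>
           (\<forall>x>0. hyp1F2 a b (3*a + 1/2 - b) x > (bessJ (a - 1/2) (x/2))^2))"
proof -
  let ?c = "3*a + 1/2 - b"
  let ?between = "(a + 1/2 < b \<and> b < 2*a) \<or> (2*a < b \<and> b < a + 1/2)"
  have gt: "hyp1F2 a b ?c x > (bessJ (a - 1/2) (x/2))^2" if "?between" "x > 0" for x
  proof -
    have e: "(x/2)^2 / 4 = x^2/4/4" "a - 1/2 + 1 = a + 1/2" by (simp_all add: power_divide)
    show ?thesis
      unfolding hyp1F2_eq_F12 bessJ_eq_F01 e
      by (rule F12_gt_square[OF assms(1) that(1)]) (use that(2) in simp)
  qed
  have "?between" if P: "(a, b, ?c) \<in> P12"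
  proof (rule ccontr)
    assume nb: "\<not> ?between"
    have c: "?c > 0" using P by (simp add: P12_def)
    have pos: "F12 a b ?c t > 0" if "t > 0" for t
    proof -
      have "hyp1F2 a b ?c (2 * sqrt t) > 0" using P that by (simp add: P12_def)
      then show ?thesis using that by (simp add: hyp1F2_eq_F12 power_mult_distrib)
    qed
    \<comment> \<open>Since \<open>b + c = 2a + (a + 1/2)\<close>, if \<open>b\<close> is not
      strictly between the two, the smaller of \<open>b\<close> and \<open>c\<close> is at most
      both; ties and \<open>a = 1/2\<close> are included.\<close>
    consider "?c \<le> min (2*a) (a + 1/2)" | "b \<le> min (2*a) (a + 1/2)"
      using nb by linarith
    then show False
    proof cases
      case 1
      then show False using F12_not_pos_if_spread[OF assms(1) c _ pos] by simp
    next
      case 2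
      then show False
        using F12_not_pos_if_spread[OF assms, of ?c, unfolded F12_commute[of a ?c]] pos by simp
    qed
  qed
  moreover have "(a, b, ?c) \<in> P12" if "?between"
  proof -
    have "?c > 0" using that assms by auto
    moreover have "hyp1F2 a b ?c x > 0" if "x > 0" for x
      using gt[OF \<open>?between\<close> that] by (meson le_less_trans zero_le_power2)
    ultimately show ?thesis using assms by (simp add: P12_def)
  qed
  \<comment> \<open>\<open>?between\<close> forces \<open>a \<noteq> 1/2\<close>, because
    \<open>2a\<close> and \<open>a + 1/2\<close> coincide there.\<close>
  ultimately show ?thesis using gt by auto
qed

end
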